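(* Let $\&$ be the {\L}ukasiewicz t-norm. Then $S_{\mathrm{L}}$-convergence in $\mathbb{E}^1$ coincides with uniform convergence: for every net $\{u_i\}_{i\in D}$ in $\mathbb{E}^1$ and every $u\in\mathbb{E}^1$, the net $\{u_i\}_{i\in D}$ is $S_{\mathrm{L}}$-convergent to $u$ if and only if $\{u_i\}_{i\in D}$ converges to $u$ uniformly on $\mathbb{R}$.
   Context: The {\L}ukasiewicz t-norm is $a\,\&\,b=\max(a+b-1,0)$ on $[0,1]$, with residuated implication $a\rightarrow c=\min(1,1-a+c)$. Fuzzy numbers: $\mathbb{E}^1$ is the set of all $u:\mathbb{R}\to[0,1]$ such that (1) $u(x_0)=1$ for some $x_0$; (2) $u(\lambda x+(1-\lambda)y)\ge\min\{u(x),u(y)\}$ for all $x,y\in\mathbb{R}$, $\lambda\in[0,1]$; (3) $u$ is upper semicontinuous; (4) $[u]_0=\overline{\{x: u(x)>0\}}$ is compact. Write $[u]_0=[u_0^-,u_0^+]$ and $[u]_1=\{x:u(x)=1\}=[u_1^-,u_1^+]$. The left part $u^\ell$ and right part $u^r$ are functions $\mathbb{R}\to[0,1]$: $u^\ell(x)=0$ for $x<u_0^-$, $u^\ell(x)=u(x)$ for $x\in[u_0^-,u_1^-]$, $u^\ell(x)=1$ for $x>u_1^-$; and $u^r(x)=1$ for $x<u_1^-$, $u^r(x)=u(x)$ for $x\in[u_1^-,u_0^+]$, $u^r(x)=0$ for $x>u_0^+$. For $u,v\in\mathbb{E}^1$: $P(u,v)=\inf_{x\in\mathbb{R}}\left[(v^\ell(x)\rightarrow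 u^\ell(x))\wedge(u^r(x)\rightarrow v^r(x))\right]$ and $S_{\mathrm{L}}(u,v)=P(u,v)\wedge P(v,u)$, using the {\L}ukasiewicz implication. A net $\{u_i\}_{i\in D}$ in $\mathbb{E}^1$ is $S_{\mathrm{L}}$-convergent to $u\in\mathbb{E}^1$ if $\sup_{i\in D}\inf_{j\ge i}S_{\mathrm{L}}(u,u_j)=1$ (equivalently, it converges to $u$ in the topology with base the balls $\{v: S_{\mathrm{L}}(w,v)>r\}$, $w\in\mathbb{E}^1$, $r<1$). Uniform convergence is with respect to the usual metric $|a-b|$ on $[0,1]$. *)

theory Defs
  imports "HOL-Analysis.Analysis"
begin

definition luk_tnorm :: "real \<Rightarrow> real \<Rightarrow> real" where
  "luk_tnorm a b = max (a + b - 1) 0"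

definition luk_imp :: "real \<Rightarrow> real \<Rightarrow> real" where
  "luk_imp a c = min 1 (1 - a + c)"

lemma luk_residuation:
  assumes "a \<in> {0..1}" "b \<in> {0..1}" "c \<in> {0..1}"
  shows "luk_tnorm a b \<le> c \<longleftrightarrow> b \<le> luk_imp a c"
  using assms by (auto simp: luk_tnorm_def luk_imp_def)

definition upper_semicont :: "(real \<Rightarrow> real) \<Rightarrow> bool" where
  "upper_semicont u \<longleftrightarrow> (\<forall>x a. u x < a \<longrightarrow> (\<forall>\<^sub>F y in nhds x. u y < a))"

definition support0 :: "(real \<Rightarrow> real) \<Rightarrow> real set" where
  "support0 u = closure {x. u x > 0}"

definition core1 :: "(real \<Rightarrow> real) \<Rightarrow> real set" where
  "core1 u = {x. u x = 1}"

definition fuzzy_numbers :: "(real \<Rightarrow> real) set" where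
  "fuzzy_numbers = {u. range u \<subseteq> {0..1}
     \<and> (\<exists>x0. u x0 = 1)
     \<and> (\<forall>x y. \<forall>l\<in>{0..1}. u (l * x + (1 - l) * y) \<ge> min (u x) (u y))
     \<and> upper_semicont u
     \<and> compact (support0 u)}"

text \<open>On fuzzy numbers the two level sets are nonempty compact intervals, so the infima and
  suprema below are their end points; see \<open>support0_eq\<close> and \<open>core1_eq\<close>.\<close>

definition lower0 :: "(real \<Rightarrow> real) \<Rightarrow> real" where
  "lower0 u = Inf (support0 u)"

definition upper0 :: "(real \<Rightarrow> real) \<Rightarrow> real" where
  "upper0 u = Sup (support0 u)"

definition lower1 :: "(real \<Rightarrow> real) \<Rightarrow> real" where
  "lower1 u = Inf (core1 u)"

definition upper1 :: "(real \<Rightarrow> real) \<Rightarrow> real" where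
  "upper1 u = Sup (core1 u)"

lemma compact_convex_real_eq:
  fixes S :: "real set"
  assumes "compact S" "convex S" "S \<noteq> {}"
  shows "S = {Inf S..Sup S}"
proof -
  have c: "closed S" "bdd_below S" "bdd_above S"
    using assms(1) by (auto simp: compact_imp_closed bounded_imp_bdd_below bounded_imp_bdd_above compact_imp_bounded)
  have "Inf S \<in> S" "Sup S \<in> S"
    using c assms(3) by (auto intro: closed_contains_Inf closed_contains_Sup)
  then have "{Inf S..Sup S} \<subseteq> S"
    using assms(2) unfolding is_interval_convex_1[symmetric] is_interval_1
    by (meson atLeastAtMost_iff subsetI)
  moreover have "S \<subseteq> {Inf S..Sup S}"
    using c by (auto intro: cInf_lower cSup_upper)
  ultimately show ?thesis by auto
qed

lemma fuzzy_range:
  assumes "u \<in> fuzzy_numbers"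
  shows "0 \<le> u x" "u x \<le> 1"
proof -
  have "u x \<in> range u" by simp
  then have "u x \<in> {0..1}" using assms unfolding fuzzy_numbers_def by blast
  then show "0 \<le> u x" "u x \<le> 1" by auto
qed

lemma fuzzy_level_convex:
  assumes "u \<in> fuzzy_numbers" "\<And>a b c. P a \<Longrightarrow> P b \<Longrightarrow> min a b \<le> c \<Longrightarrow> c \<le> 1 \<Longrightarrow> P c"
  shows "convex {x. P (u x)}"
proof (rule convexI)
  fix x y s t :: real
  assume xy: "x \<in> {x. P (u x)}" "y \<in> {x. P (u x)}" and s: "0 \<le> s" "0 \<le> t" "s + t = 1"
  have t: "t = 1 - s" "s \<in> {0..1}" using s by auto
  have "min (u x) (u y) \<le> u (s * x + t * y)"
    using assms(1) t by (simp add: fuzzy_numbers_def)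
  moreover note fuzzy_range(2)[OF assms(1), of "s * x + t * y"]
  ultimately show "s *\<^sub>R x + t *\<^sub>R y \<in> {x. P (u x)}"
    using assms(2)[of "u x" "u y"] xy by simp
qed

lemma support0_eq:
  assumes "u \<in> fuzzy_numbers"
  shows "support0 u = {lower0 u..upper0 u}"
proof -
  obtain x0 where "u x0 = 1" using assms by (auto simp: fuzzy_numbers_def)
  then have "x0 \<in> {x. u x > 0}" by simp
  then have "support0 u \<noteq> {}" unfolding support0_def using closure_subset by blast
  moreover have "convex (support0 u)"
    unfolding support0_def by (intro convex_closure fuzzy_level_convex[OF assms]) auto
  moreover have "compact (support0 u)" using assms by (simp add: fuzzy_numbers_def)
  ultimately show ?thesis
    unfolding lower0_def upper0_def by (intro compact_convex_real_eq)
qed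

lemma core1_eq:
  assumes "u \<in> fuzzy_numbers"
  shows "core1 u = {lower1 u..upper1 u}"
proof -
  have "core1 u \<noteq> {}" using assms by (auto simp: fuzzy_numbers_def core1_def)
  moreover have "convex (core1 u)"
    unfolding core1_def by (intro fuzzy_level_convex[OF assms]) auto
  moreover have "open (- core1 u)"
  proof (subst open_subopen, intro ballI)
    fix x assume "x \<in> - core1 u"
    then have "u x < 1"
      using fuzzy_range(2)[OF assms, of x] by (simp add: core1_def)
    then have "\<forall>\<^sub>F y in nhds x. u y < 1"
      using assms by (auto simp: fuzzy_numbers_def upper_semicont_def)
    then obtain T where "open T" "x \<in> T" "\<forall>y\<in>T. u y < 1"
      by (auto simp: eventually_nhds)
    then show "\<exists>T. open T \<and> x \<in> T \<and> T \<subseteq> - core1 u"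
      by (intro exI[of _ T]) (auto simp: core1_def)
  qed
  then have "closed (core1 u)" by (simp add: closed_def)
  moreover have "core1 u \<subseteq> support0 u"
    using closure_subset by (fastforce simp: core1_def support0_def)
  moreover have "compact (support0 u)" using assms by (simp add: fuzzy_numbers_def)
  ultimately have "compact (core1 u)"
    by (metis compact_Int_closed inf.absorb_iff2)
  with \<open>core1 u \<noteq> {}\<close> \<open>convex (core1 u)\<close> show ?thesis
    unfolding lower1_def upper1_def
    by (intro compact_convex_real_eq)
qed

definition left_part :: "(real \<Rightarrow> real) \<Rightarrow> real \<Rightarrow> real" where
  "left_part u x = (if x < lower0 u then 0 else if x \<le> lower1 u then u x else 1)"

definition right_part :: "(real \<Rightarrow> real) \<Rightarrow> real \<Rightarrow> real" where
  "right_part u x = (if x < lower1 u then 1 else if x \<le> upper0 u then u x else 0)"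

definition P_luk :: "(real \<Rightarrow> real) \<Rightarrow> (real \<Rightarrow> real) \<Rightarrow> real" where
  "P_luk u v = (INF x. min (luk_imp (left_part v x) (left_part u x))
                            (luk_imp (right_part u x) (right_part v x)))"

definition S_luk :: "(real \<Rightarrow> real) \<Rightarrow> (real \<Rightarrow> real) \<Rightarrow> real" where
  "S_luk u v = min (P_luk u v) (P_luk v u)"

definition directed_set :: "'i set \<Rightarrow> ('i \<Rightarrow> 'i \<Rightarrow> bool) \<Rightarrow> bool" where
  "directed_set D le \<longleftrightarrow> D \<noteq> {} \<and> reflp_on D le \<and> transp_on D le
     \<and> (\<forall>i\<in>D. \<forall>j\<in>D. \<exists>k\<in>D. le i k \<and> le j k)"

definition S_luk_convergent ::
  "'i set \<Rightarrow> ('i \<Rightarrow> 'i \<Rightarrow> bool) \<Rightarrow> ('i \<Rightarrow> real \<Rightarrow> real) \<Rightarrow> (real \<Rightarrow> real) \<Rightarrow> bool" where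
  "S_luk_convergent D le us u \<longleftrightarrow>
     (SUP i\<in>D. INF j\<in>{j\<in>D. le i j}. S_luk u (us j)) = 1"

text \<open>The filter of tails of a net, through which the library's filter-based limits apply to nets.\<close>

definition net_filter :: "'i set \<Rightarrow> ('i \<Rightarrow> 'i \<Rightarrow> bool) \<Rightarrow> 'i filter" where
  "net_filter D le = (INF i\<in>D. principal {j\<in>D. le i j})"

lemma eventually_net_filter:
  assumes "directed_set D le"
  shows "eventually Q (net_filter D le) \<longleftrightarrow> (\<exists>i\<in>D. \<forall>j\<in>D. le i j \<longrightarrow> Q j)"
proof -
  have "eventually Q (net_filter D le) \<longleftrightarrow> (\<exists>i\<in>D. eventually Q (principal {j\<in>D. le i j}))"
    unfolding net_filter_def
  proof (rule eventually_INF_base)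
    show "D \<noteq> {}" using assms by (simp add: directed_set_def)
    fix a b assume ab: "a \<in> D" "b \<in> D"
    then obtain k where k: "k \<in> D" "le a k" "le b k"
      using assms by (auto simp: directed_set_def)
    have "transp_on D le" using assms by (simp add: directed_set_def)
    then have "{j\<in>D. le k j} \<subseteq> {j\<in>D. le a j} \<inter> {j\<in>D. le b j}"
      using ab k by (auto dest: transp_onD)
    with k(1) show "\<exists>x\<in>D. principal {j\<in>D. le x j} \<le> inf (principal {j\<in>D. le a j}) (principal {j\<in>D. le b j})"
      by (intro bexI[of _ k]) simp_all
  qed
  then show ?thesis by (auto simp: eventually_principal)
qed

lemma uniform_limit_net_filter:
  fixes us :: "'i \<Rightarrow> real \<Rightarrow> real"
  assumes "directed_set D le"
  shows "uniform_limit UNIV us u (net_filter D le) \<longleftrightarrow>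
    (\<forall>e>0. \<exists>i\<in>D. \<forall>j\<in>D. le i j \<longrightarrow> (\<forall>x. \<bar>us j x - u x\<bar> < e))"
  by (simp add: uniform_limit_iff eventually_net_filter[OF assms] dist_real_def)

end

theory Submission
  imports Defs
begin

text \<open>
  For the Lukasiewicz implication, \<open>luk_imp a c \<ge> 1 - e\<close> says exactly \<open>a - c \<le> e\<close> (for
  \<open>e \<ge> 0\<close>).  Unfolding the infima, \<open>S_luk u v \<ge> 1 - e\<close> therefore means that the left parts of \<open>u\<close>
  and \<open>v\<close>, and likewise their right parts, differ by at most \<open>e\<close> everywhere.

  The heart of the matter is that this is the same as \<open>\<bar>u x - v x\<bar> \<le> e\<close> for all \<open>x\<close>, so that
  \<open>1 - S_luk u v\<close> is the supremum distance of \<open>u\<close> and \<open>v\<close>.  By quasiconcavity the left part at \<open>x\<close>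
  is the maximum of \<open>u\<close> over \<open>{..x}\<close> and the right part at \<open>x\<close> the maximum of \<open>u\<close> over \<open>{x..}\<close>;
  taking such maxima does not increase the supremum distance.  Conversely \<open>u\<close> is the pointwise
  minimum of its two parts, and a minimum does not increase the distance either
  (\<open>parts_close_iff\<close>, \<open>S_luk_ge_iff\<close>).

  Both notions of convergence then say that for every \<open>e > 0\<close> the supremum distance between \<open>u\<close>
  and the members of the net is eventually at most \<open>e\<close>.
\<close>

lemma fuzzy_quasiconcave:
  assumes "u \<in> fuzzy_numbers" "x \<le> y" "y \<le> z"
  shows "min (u x) (u z) \<le> u y"
proof -
  have "convex {t. min (u x) (u z) \<le> u t}"
    by (rule fuzzy_level_convex[OF assms(1)]) auto
  then have "is_interval {t. min (u x) (u z) \<le> u t}"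
    by (simp add: is_interval_convex_1)
  then show ?thesis
    using mem_is_interval_1_I[OF _ _ _ assms(2,3)] by fastforce
qed

lemma fuzzy_lower1:
  assumes "u \<in> fuzzy_numbers"
  shows "u (lower1 u) = 1"
proof -
  have "core1 u \<noteq> {}" using assms by (auto simp: fuzzy_numbers_def core1_def)
  then have "lower1 u \<in> core1 u" using core1_eq[OF assms] by auto
  then show ?thesis by (simp add: core1_def)
qed

lemma fuzzy_zero_outside:
  assumes "u \<in> fuzzy_numbers" "x < lower0 u \<or> upper0 u < x"
  shows "u x = 0"
proof -
  have "x \<notin> support0 u" using assms(2) by (auto simp: support0_eq[OF assms(1)])
  then have "x \<notin> {x. 0 < u x}" using closure_subset[of "{x. 0 < u x}"] by (auto simp: support0_def)
  then show ?thesis using fuzzy_range(1)[OF assms(1), of x] by simp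
qed

lemma lower0_le_lower1:
  assumes "u \<in> fuzzy_numbers"
  shows "lower0 u \<le> lower1 u"
proof (rule ccontr)
  assume "\<not> ?thesis"
  then have "u (lower1 u) = 0" by (simp add: fuzzy_zero_outside[OF assms])
  then show False by (simp add: fuzzy_lower1[OF assms])
qed

text \<open>Since \<open>u\<close> vanishes beyond the end points of its support, the three cases defining each part
  merge into two, separated by the left end of the core.\<close>

lemma left_part_eq:
  assumes "u \<in> fuzzy_numbers"
  shows "left_part u x = (if x \<le> lower1 u then u x else 1)"
  using fuzzy_zero_outside[OF assms, of x] lower0_le_lower1[OF assms] by (auto simp: left_part_def)

lemma right_part_eq:
  assumes "u \<in> fuzzy_numbers"
  shows "right_part u x = (if x < lower1 u then 1 else u x)"
  using fuzzy_zero_outside[OF assms, of x] by (auto simp: right_part_def)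

lemma left_part_bounds:
  assumes "u \<in> fuzzy_numbers"
  shows "0 \<le> left_part u x" "left_part u x \<le> 1"
  using fuzzy_range[OF assms, of x] by (auto simp: left_part_eq[OF assms])

lemma right_part_bounds:
  assumes "u \<in> fuzzy_numbers"
  shows "0 \<le> right_part u x" "right_part u x \<le> 1"
  using fuzzy_range[OF assms, of x] by (auto simp: right_part_eq[OF assms])

text \<open>The next four lemmas identify the left and right parts with running maxima of \<open>u\<close>, an upper
  bound and its attainment for each.  If the half-line contains \<open>lower1 u\<close>, the
  maximum is 1 and is attained there; otherwise \<open>u\<close> is monotone on it and the maximum is attained
  at its end point \<open>x\<close>.\<close>

lemma le_left_part:
  assumes "u \<in> fuzzy_numbers" "y \<le> x"
  shows "u y \<le> left_part u x"
  using fuzzy_quasiconcave[OF assms, of "lower1 u"] fuzzy_lower1[OF assms(1)]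
    fuzzy_range(2)[OF assms(1), of y]
  by (auto simp: left_part_eq[OF assms(1)])

lemma left_part_attained:
  assumes "u \<in> fuzzy_numbers"
  obtains y where "y \<le> x" "left_part u x = u y"
  using that[of x] that[of "lower1 u"] fuzzy_lower1[OF assms]
  by (cases "x \<le> lower1 u") (auto simp: left_part_eq[OF assms])

lemma le_right_part:
  assumes "u \<in> fuzzy_numbers" "x \<le> y"
  shows "u y \<le> right_part u x"
  using fuzzy_quasiconcave[OF assms(1) _ assms(2), of "lower1 u"] fuzzy_lower1[OF assms(1)]
    fuzzy_range(2)[OF assms(1), of y]
  by (auto simp: right_part_eq[OF assms(1)])

lemma right_part_attained:
  assumes "u \<in> fuzzy_numbers"
  obtains y where "x \<le> y" "right_part u x = u y"
  using that[of x] that[of "lower1 u"] fuzzy_lower1[OF assms]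
  by (cases "x < lower1 u") (auto simp: right_part_eq[OF assms])

lemma fuzzy_eq_min_parts:
  assumes "u \<in> fuzzy_numbers"
  shows "u x = min (left_part u x) (right_part u x)"
  using fuzzy_lower1[OF assms] fuzzy_range(2)[OF assms, of x]
  by (cases "x = lower1 u") (auto simp: left_part_eq[OF assms] right_part_eq[OF assms])

text \<open>A maximum of \<open>u\<close> over a half-line is attained at some point of it; there \<open>v\<close> is smaller by at
  most \<open>e\<close>, so the maximum of \<open>v\<close> over that half-line falls short by at most \<open>e\<close> too.  The bound is one-sided so that
  exchanging \<open>u\<close> and \<open>v\<close> yields the other side.\<close>

lemma parts_le_of_le:
  assumes u: "u \<in> fuzzy_numbers" and v: "v \<in> fuzzy_numbers" and le: "\<And>x. u x \<le> v x + e"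
  shows "left_part u x \<le> left_part v x + e" "right_part u x \<le> right_part v x + e"
proof -
  obtain y where "y \<le> x" "left_part u x = u y" by (rule left_part_attained[OF u])
  then show "left_part u x \<le> left_part v x + e"
    using le[of y] le_left_part[OF v, of y x] by linarith
  obtain z where "x \<le> z" "right_part u x = u z" by (rule right_part_attained[OF u])
  then show "right_part u x \<le> right_part v x + e"
    using le[of z] le_right_part[OF v, of x z] by linarith
qed

lemma parts_close_iff:
  assumes u: "u \<in> fuzzy_numbers" and v: "v \<in> fuzzy_numbers"
  shows "(\<forall>x. \<bar>left_part u x - left_part v x\<bar> \<le> e \<and> \<bar>right_part u x - right_part v x\<bar> \<le> e)
    \<longleftrightarrow> (\<forall>x. \<bar>u x - v x\<bar> \<le> e)"
proof (intro iffI allI)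
  fix x
  assume "\<forall>x. \<bar>left_part u x - left_part v x\<bar> \<le> e \<and> \<bar>right_part u x - right_part v x\<bar> \<le> e"
  then have "\<bar>left_part u x - left_part v x\<bar> \<le> e" "\<bar>right_part u x - right_part v x\<bar> \<le> e" by auto
  then show "\<bar>u x - v x\<bar> \<le> e"
    unfolding fuzzy_eq_min_parts[OF u, of x] fuzzy_eq_min_parts[OF v, of x] by linarith
next
  fix x
  assume close: "\<forall>x. \<bar>u x - v x\<bar> \<le> e"
  have uv: "u y \<le> v y + e" and vu: "v y \<le> u y + e" for y
    using close[rule_format, of y] by linarith+
  show "\<bar>left_part u x - left_part v x\<bar> \<le> e \<and> \<bar>right_part u x - right_part v x\<bar> \<le> e"
    using parts_le_of_le[OF u v uv, of x] parts_le_of_le[OF v u vu, of x] by linarith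
qed

text \<open>A real infimum is a genuine lower bound only for a family bounded below; here the terms are
  nonnegative because the parts take values in the unit interval.\<close>

lemma P_luk_bdd_below:
  assumes u: "u \<in> fuzzy_numbers" and v: "v \<in> fuzzy_numbers"
  shows "bdd_below (range (\<lambda>x. min (luk_imp (left_part v x) (left_part u x))
                                    (luk_imp (right_part u x) (right_part v x))))"
proof (rule bdd_belowI2[where m = 0])
  fix x
  show "0 \<le> min (luk_imp (left_part v x) (left_part u x)) (luk_imp (right_part u x) (right_part v x))"
    using left_part_bounds[OF u, of x] left_part_bounds[OF v, of x]
      right_part_bounds[OF u, of x] right_part_bounds[OF v, of x]
    by (auto simp: luk_imp_def)
qed

lemma P_luk_ge_iff:
  assumes u: "u \<in> fuzzy_numbers" and v: "v \<in> fuzzy_numbers" and e: "0 \<le> e"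
  shows "1 - e \<le> P_luk u v \<longleftrightarrow>
    (\<forall>x. left_part v x - left_part u x \<le> e \<and> right_part u x - right_part v x \<le> e)"
proof -
  have imp: "1 - e \<le> luk_imp a c \<longleftrightarrow> a - c \<le> e" for a c
    using e by (auto simp: luk_imp_def)
  show ?thesis
    unfolding P_luk_def by (subst le_cINF_iff[OF _ P_luk_bdd_below[OF u v]]) (simp_all add: imp)
qed

lemma S_luk_ge_iff:
  assumes u: "u \<in> fuzzy_numbers" and v: "v \<in> fuzzy_numbers" and e: "0 \<le> e"
  shows "1 - e \<le> S_luk u v \<longleftrightarrow> (\<forall>x. \<bar>u x - v x\<bar> \<le> e)"
  unfolding S_luk_def min.bounded_iff P_luk_ge_iff[OF u v e] P_luk_ge_iff[OF v u e]
    parts_close_iff[OF u v, symmetric]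
  by (auto simp: abs_le_iff)

lemma S_luk_bounds:
  assumes u: "u \<in> fuzzy_numbers" and v: "v \<in> fuzzy_numbers"
  shows "0 \<le> S_luk u v" "S_luk u v \<le> 1"
proof -
  have "\<bar>u x - v x\<bar> \<le> 1" for x
    using fuzzy_range[OF u, of x] fuzzy_range[OF v, of x] by linarith
  then show "0 \<le> S_luk u v" using S_luk_ge_iff[OF u v, of 1] by simp
  have "P_luk u v \<le> min (luk_imp (left_part v 0) (left_part u 0)) (luk_imp (right_part u 0) (right_part v 0))"
    unfolding P_luk_def by (rule cINF_lower[OF P_luk_bdd_below[OF u v]]) simp
  then show "S_luk u v \<le> 1" by (auto simp: S_luk_def luk_imp_def min_le_iff_disj)
qed

text \<open>A lower limit along a net, for values in the unit interval, equals 1 exactly when the values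
  are eventually above \<open>1 - e\<close>, for every \<open>e > 0\<close>.  Reflexivity makes every tail nonempty, so the
  real-valued infima are infima of nonempty bounded sets.\<close>

lemma SUP_INF_tails_eq_1_iff:
  fixes f :: "'i \<Rightarrow> real"
  assumes D: "D \<noteq> {}" "reflp_on D le" and f: "\<And>j. j \<in> D \<Longrightarrow> 0 \<le> f j" "\<And>j. j \<in> D \<Longrightarrow> f j \<le> 1"
  shows "(SUP i\<in>D. INF j\<in>{j\<in>D. le i j}. f j) = 1
    \<longleftrightarrow> (\<forall>e>0. \<exists>i\<in>D. \<forall>j\<in>D. le i j \<longrightarrow> 1 - e \<le> f j)"
proof -
  define g where "g i = (INF j\<in>{j\<in>D. le i j}. f j)" for i
  have refl: "i \<in> {j\<in>D. le i j}" if "i \<in> D" for i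
    using that D(2) by (auto dest: reflp_onD)
  have bdd: "bdd_below (f ` {j\<in>D. le i j})" for i
    using f(1) by (auto intro!: bdd_belowI2[where m = 0])
  have g_ge: "a \<le> g i \<longleftrightarrow> (\<forall>j\<in>D. le i j \<longrightarrow> a \<le> f j)" if "i \<in> D" for i a
    unfolding g_def using refl[OF that] by (subst le_cINF_iff[OF _ bdd]) auto
  have g_le: "g i \<le> 1" if "i \<in> D" for i
    unfolding g_def using cINF_lower[OF bdd refl[OF that]] f(2)[OF that] by linarith
  have bdd_g: "bdd_above (g ` D)" using g_le by (rule bdd_aboveI2)
  have "(SUP i\<in>D. g i) \<le> 1" using D(1) g_le by (rule cSUP_least)
  then have "(SUP i\<in>D. g i) = 1 \<longleftrightarrow> (\<forall>y<1. \<exists>i\<in>D. y < g i)"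
    using le_cSUP_iff[OF D(1) bdd_g, of 1] by auto
  also have "\<dots> \<longleftrightarrow> (\<forall>e>0. \<exists>i\<in>D. 1 - e \<le> g i)"
  proof (intro iffI allI impI)
    fix e :: real assume "\<forall>y<1. \<exists>i\<in>D. y < g i" "0 < e"
    then have "\<exists>i\<in>D. 1 - e < g i" by simp
    then show "\<exists>i\<in>D. 1 - e \<le> g i" by (auto intro: less_imp_le)
  next
    fix y :: real assume ge: "\<forall>e>0. \<exists>i\<in>D. 1 - e \<le> g i" and y: "y < 1"
    obtain i where i: "i \<in> D" "1 - (1 - y) / 2 \<le> g i"
      using ge[rule_format, of "(1 - y) / 2"] y by auto
    have "y < 1 - (1 - y) / 2" using y by (simp add: field_simps)
    also note i(2)
    finally show "\<exists>i\<in>D. y < g i" using i(1) by blast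
  qed
  also have "\<dots> \<longleftrightarrow> (\<forall>e>0. \<exists>i\<in>D. \<forall>j\<in>D. le i j \<longrightarrow> 1 - e \<le> f j)"
    using g_ge by simp
  finally show ?thesis by (simp only: g_def)
qed

theorem proposition3p6:
  fixes D :: "'i set" and le :: "'i \<Rightarrow> 'i \<Rightarrow> bool"
    and us :: "'i \<Rightarrow> real \<Rightarrow> real" and u :: "real \<Rightarrow> real"
  assumes "directed_set D le"
    and "\<And>i. i \<in> D \<Longrightarrow> us i \<in> fuzzy_numbers"
    and "u \<in> fuzzy_numbers"
  shows "S_luk_convergent D le us u \<longleftrightarrow> uniform_limit UNIV us u (net_filter D le)"
proof -
  have D: "D \<noteq> {}" "reflp_on D le" using assms(1) by (auto simp: directed_set_def)
  have "S_luk_convergent D le us u \<longleftrightarrow>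
      (\<forall>e>0. \<exists>i\<in>D. \<forall>j\<in>D. le i j \<longrightarrow> 1 - e \<le> S_luk u (us j))"
    unfolding S_luk_convergent_def
    by (rule SUP_INF_tails_eq_1_iff[OF D]) (simp_all add: S_luk_bounds assms(2,3))
  also have "\<dots> \<longleftrightarrow> (\<forall>e>0. \<exists>i\<in>D. \<forall>j\<in>D. le i j \<longrightarrow> (\<forall>x. \<bar>us j x - u x\<bar> \<le> e))"
    by (simp add: S_luk_ge_iff[OF assms(3) assms(2)] abs_minus_commute)
  also have "\<dots> \<longleftrightarrow> (\<forall>e>0. \<exists>i\<in>D. \<forall>j\<in>D. le i j \<longrightarrow> (\<forall>x. \<bar>us j x - u x\<bar> < e))"
  proof (intro iffI allI impI)
    fix e :: real
    assume close: "\<forall>e>0. \<exists>i\<in>D. \<forall>j\<in>D. le i j \<longrightarrow> (\<forall>x. \<bar>us j x - u x\<bar> \<le> e)" and "0 < e"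
    then obtain i where "i \<in> D" "\<forall>j\<in>D. le i j \<longrightarrow> (\<forall>x. \<bar>us j x - u x\<bar> \<le> e / 2)"
      using half_gt_zero by blast
    moreover have "e / 2 < e" using \<open>0 < e\<close> by simp
    ultimately show "\<exists>i\<in>D. \<forall>j\<in>D. le i j \<longrightarrow> (\<forall>x. \<bar>us j x - u x\<bar> < e)"
      by (blast intro: le_less_trans)
  qed (blast intro: less_imp_le)
  also have "\<dots> \<longleftrightarrow> uniform_limit UNIV us u (net_filter D le)"
    by (rule uniform_limit_net_filter[OF assms(1), symmetric])
  finally show ?thesis .
qed

end
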